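(* The squeezing function $s_D$ of any bounded domain $D$ in $\mathbb{C}^n$ is continuous on $D$.
   Context: $B^n$ is the open unit ball in $\mathbb{C}^n$ and $B^n(0,r)$ is the open ball with center $0$ and radius $r$. A holomorphic embedding $f:D\to B^n$ means an (open) injective holomorphic map. For a bounded domain $D\subset\mathbb{C}^n$, $p\in D$ and a holomorphic embedding $f: D\rightarrow B^n$ with $f(p)=0$, put $s_D(p,f)=\sup\{r : B^n(0,r)\subset f(D)\}$. The squeezing function of $D$ is $s_D(p)=\sup_f s_D(p,f)$, the supremum being over all holomorphic embeddings $f: D\rightarrow B^n$ with $f(p)=0$. *)

theory Defs
  imports "HOL-Analysis.Analysis"
begin

text \<open>
  The space of \<open>n\<close> complex variables is \<open>complex ^ 'n\<close>; its \<^const>\<open>norm\<close> is the Hermitian norm,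
  so \<open>ball 0 1\<close> is the open unit ball.  The library's \<open>holomorphic_on\<close> covers one variable only.
  A map of several variables is holomorphic on an open set if it has a complex-linear (Frechet)
  derivative at each point.  Note that \<open>*s\<close> is multiplication by complex scalars.
\<close>

definition holomorphic_map_on ::
  "(complex ^ 'n \<Rightarrow> complex ^ 'm) \<Rightarrow> (complex ^ 'n) set \<Rightarrow> bool"
  where "holomorphic_map_on f D \<longleftrightarrow>
    (\<forall>z\<in>D. \<exists>f'. (f has_derivative f') (at z) \<and> Vector_Spaces.linear (*s) (*s) f')"

definition holomorphic_embedding ::
  "(complex ^ 'n) set \<Rightarrow> (complex ^ 'n \<Rightarrow> complex ^ 'n) \<Rightarrow> bool"
  where "holomorphic_embedding D f \<longleftrightarrow>
    holomorphic_map_on f D \<and> inj_on f D \<and> f ` D \<subseteq> ball 0 1 \<and>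
    open_map (top_of_set D) (top_of_set (ball 0 1)) f"

definition squeezing_at ::
  "(complex ^ 'n) set \<Rightarrow> (complex ^ 'n \<Rightarrow> complex ^ 'n) \<Rightarrow> real"
  where "squeezing_at D f = Sup {r. 0 < r \<and> ball 0 r \<subseteq> f ` D}"

text \<open>
  Both suprema are suprema in the conditionally complete type \<^typ>\<open>real\<close>.  For \<open>D\<close> open and
  bounded and \<open>p \<in> D\<close> they range over nonempty sets of numbers in \<open>{0<..1}\<close>.
\<close>

definition squeezing_function :: "(complex ^ 'n) set \<Rightarrow> complex ^ 'n \<Rightarrow> real"
  where "squeezing_function D p =
    (SUP f \<in> {f. holomorphic_embedding D f \<and> f p = 0}. squeezing_at D f)"

end

theory Submission
  imports Defs "HOL-Complex_Analysis.Conformal_Mappings"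
begin

text \<open>
  If \<open>f\<close> is an embedding with \<open>f p = 0\<close> whose image contains \<open>B(0,r)\<close> and \<open>a = f q\<close>, then
  \<open>(f - a) / (1 + |a|)\<close> is an embedding into the unit ball that sends \<open>q\<close> to \<open>0\<close> and whose image
  contains \<open>B(0, (r - |a|) / (1 + |a|))\<close>.  The Schwarz lemma on complex lines bounds \<open>|a|\<close> by a
  multiple of \<open>|q - p|\<close> that does not depend on \<open>f\<close>, so the squeezing function is locally Lipschitz.
\<close>

section \<open>The Schwarz lemma along complex lines\<close>

lemma norm_complex_scale:
  fixes w :: "complex ^ 'n"
  shows "norm (c *s w) = norm c * norm w"
  by (simp add: norm_vec_def norm_mult L2_set_right_distrib)

lemma norm_vec_le_sum_components:
  fixes x :: "'a::real_normed_vector ^ 'n"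
  shows "norm x \<le> (\<Sum>i\<in>UNIV. norm (x $ i))"
  unfolding norm_vec_def by (rule L2_set_le_sum) simp

text \<open>By the chain rule the real derivative at \<open>t\<close> is
  \<open>f' (t *s w) $ i\<close>. Complex linearity of \<open>f'\<close> turns this into
  multiplication by the number \<open>f' w $ i\<close>, which is complex differentiability in one
  variable.\<close>

lemma holomorphic_on_complex_line:
  fixes f :: "complex ^ 'n \<Rightarrow> complex ^ 'm"
  assumes "holomorphic_map_on f D" and "\<And>t. t \<in> S \<Longrightarrow> p + t *s w \<in> D"
  shows "(\<lambda>t. f (p + t *s w) $ i) holomorphic_on S"
proof (rule holomorphic_onI)
  fix t assume "t \<in> S"
  then obtain f' where f': "(f has_derivative f') (at (p + t *s w))"
    and lin: "Vector_Spaces.linear (*s) (*s) f'"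
    using assms unfolding holomorphic_map_on_def by blast
  have "bounded_linear (\<lambda>t::complex. t *s w)"
    by (rule bounded_linear_intro[where K = "norm w"])
       (auto simp: vec_eq_iff algebra_simps norm_complex_scale)
  then have "((\<lambda>t. p + t *s w) has_derivative (\<lambda>t. t *s w)) (at t)"
    by (auto intro!: derivative_eq_intros bounded_linear_imp_has_derivative)
  from has_derivative_compose[OF this f']
  have "((\<lambda>t. f (p + t *s w)) has_derivative (\<lambda>t. f' (t *s w))) (at t)" .
  then have "((\<lambda>t. f (p + t *s w) $ i) has_derivative (\<lambda>t. f' (t *s w) $ i)) (at t)"
    by (rule bounded_linear.has_derivative[OF bounded_linear_vec_nth])
  moreover have "(\<lambda>t. f' (t *s w) $ i) = (*) (f' w $ i)"
    using vec.linear_scale[OF lin] by (auto simp: mult.commute)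
  ultimately have "((\<lambda>t. f (p + t *s w) $ i) has_field_derivative (f' w $ i)) (at t)"
    by (simp add: has_field_derivative_def)
  then show "(\<lambda>t. f (p + t *s w) $ i) field_differentiable at t within S"
    using field_differentiable_at_within field_differentiable_def by blast
qed

text \<open>Restricted to the complex line through \<open>p\<close> and \<open>q\<close>, each
  component of \<open>f\<close> is a holomorphic function from the unit disc into itself that fixes
  0, so the one-variable Schwarz lemma applies. The bound is the same for all embeddings
  \<open>f\<close>.\<close>

lemma schwarz_component_bound:
  fixes f :: "complex ^ 'n \<Rightarrow> complex ^ 'm"
  assumes hol: "holomorphic_map_on f D" and im: "f ` D \<subseteq> ball 0 1" and "f p = 0"
    and "0 < d" and ball: "ball p d \<subseteq> D" and q: "dist p q < d"
  shows "norm (f q $ i) \<le> dist p q / d"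
proof (cases "q = p")
  case True
  then show ?thesis using assms by simp
next
  case False
  define e where "e = dist p q"
  \<comment> \<open>The direction has norm \<open>d\<close>, so the open unit disc of parameters
    stays inside \<open>ball p d\<close>, and \<open>q\<close> is reached at the parameter
    \<open>e / d\<close>. Dividing by \<open>e\<close> is why \<open>q = p\<close> was treated
    apart.\<close>
  define w where "w = complex_of_real (d / e) *s (q - p)"
  define t where "t = complex_of_real (e / d)"
  have e: "0 < e" "e < d" using False q by (auto simp: e_def)
  have w: "norm w = d"
    using e \<open>0 < d\<close> unfolding w_def norm_complex_scale
    by (simp add: e_def dist_norm norm_minus_commute norm_divide)
  have tw: "p + t *s w = q"
    using e \<open>0 < d\<close> unfolding w_def t_def by (simp add: vec_eq_iff)
  have t: "norm t = e / d" using e by (simp add: t_def norm_divide)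
  have inD: "p + s *s w \<in> D" if "norm s < 1" for s
  proof -
    have "norm (s *s w) < d"
      unfolding norm_complex_scale w using that \<open>0 < d\<close> by simp
    then show ?thesis using ball by (auto simp: dist_norm)
  qed
  have "norm (f (p + t *s w) $ i) \<le> norm t"
  proof (rule Schwarz_Lemma(1))
    show "(\<lambda>t. f (p + t *s w) $ i) holomorphic_on ball 0 1"
      using hol inD by (intro holomorphic_on_complex_line) auto
    show "f (p + 0 *s w) $ i = 0" using \<open>f p = 0\<close> by simp
    show "norm (f (p + s *s w) $ i) < 1" if "norm s < 1" for s
    proof -
      have "norm (f (p + s *s w)) < 1" using inD[OF that] im by auto
      then show ?thesis using Finite_Cartesian_Product.norm_nth_le le_less_trans by blast
    qed
    show "norm t < 1" using t e by simp
  qed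
  then show ?thesis by (simp add: tw t e_def)
qed

section \<open>Embeddings into the unit ball and their affine rescalings\<close>

lemma holomorphic_embedding_affine:
  fixes f :: "complex ^ 'n \<Rightarrow> complex ^ 'n"
  assumes hol: "holomorphic_map_on f D" and inj: "inj_on f D"
    and op: "\<And>U. open U \<Longrightarrow> U \<subseteq> D \<Longrightarrow> open (f ` U)" and "open D" and "c \<noteq> 0"
    and im: "\<And>z. z \<in> D \<Longrightarrow> norm (b + c *\<^sub>R f z) < 1"
  shows "holomorphic_embedding D (\<lambda>z. b + c *\<^sub>R f z)"
  unfolding holomorphic_embedding_def
proof (intro conjI)
  show "holomorphic_map_on (\<lambda>z. b + c *\<^sub>R f z) D"
    unfolding holomorphic_map_on_def
  proof
    fix z assume "z \<in> D"
    then obtain f' where f': "(f has_derivative f') (at z)"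
      and lin: "Vector_Spaces.linear (*s) (*s) f'"
      using hol unfolding holomorphic_map_on_def by blast
    have "((\<lambda>z. b + c *\<^sub>R f z) has_derivative (\<lambda>v. c *\<^sub>R f' v)) (at z)"
      using f' by (auto intro!: derivative_eq_intros)
    moreover have "Vector_Spaces.linear (*s) (*s) (\<lambda>v. c *\<^sub>R f' v)"
      using lin unfolding Vector_Spaces.linear_iff
      by (auto simp: vec_eq_iff scaleR_add_right)
    ultimately show "\<exists>f'. ((\<lambda>z. b + c *\<^sub>R f z) has_derivative f') (at z) \<and>
        Vector_Spaces.linear (*s) (*s) f'" by blast
  qed
  show "inj_on (\<lambda>z. b + c *\<^sub>R f z) D" using inj \<open>c \<noteq> 0\<close> by (simp add: inj_on_def)
  show sub: "(\<lambda>z. b + c *\<^sub>R f z) ` D \<subseteq> ball 0 1" using im by auto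
  show "open_map (top_of_set D) (top_of_set (ball 0 1)) (\<lambda>z. b + c *\<^sub>R f z)"
    unfolding open_map_def
  proof (intro allI impI)
    fix U assume "openin (top_of_set D) U"
    then have "open U" "U \<subseteq> D" using \<open>open D\<close> openin_open_eq by auto
    \<comment> \<open>An affine map with nonzero scale factor carries open sets to open
      sets.\<close>
    then have "open ((\<lambda>x. b + c *\<^sub>R x) ` f ` U)" using op \<open>c \<noteq> 0\<close> by (intro open_affinity) auto
    then show "openin (top_of_set (ball 0 1)) ((\<lambda>z. b + c *\<^sub>R f z) ` U)"
      using sub \<open>U \<subseteq> D\<close> by (auto simp: image_image openin_open_eq)
  qed
qed

lemma holomorphic_embedding_open_image:
  fixes f :: "complex ^ 'n \<Rightarrow> complex ^ 'n"
  assumes "holomorphic_embedding D f" and "open D" and "open U" and "U \<subseteq> D"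
  shows "open (f ` U)"
  using assms unfolding holomorphic_embedding_def open_map_def
  by (metis open_ball openin_open_eq)

lemma holomorphic_embedding_exists:
  fixes D :: "(complex ^ 'n) set"
  assumes "open D" and "bounded D"
  obtains f where "holomorphic_embedding D f" and "f p = 0"
proof -
  obtain R where R: "0 < R" "D \<subseteq> ball p R"
    using bounded_subset_ballD[OF \<open>bounded D\<close>] by blast
  \<comment> \<open>This is the map sending \<open>z\<close> to \<open>(z - p) / R\<close>. The
    affine lemma asks only that the rescaled values lie in the unit ball, so it applies to
    \<open>id\<close> although \<open>D\<close> itself may be larger than that ball.\<close>
  have "holomorphic_embedding D (\<lambda>z. - (1/R) *\<^sub>R p + (1/R) *\<^sub>R id z)"
  proof (rule holomorphic_embedding_affine)
    show "holomorphic_map_on id D"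
      unfolding holomorphic_map_on_def
      using has_derivative_id vec.linear_id by blast
    show "norm (- (1/R) *\<^sub>R p + (1/R) *\<^sub>R id z) < 1" if "z \<in> D" for z
    proof -
      have "norm (z - p) < R" using R that by (auto simp: dist_norm norm_minus_commute)
      moreover have "- (1/R) *\<^sub>R p + (1/R) *\<^sub>R id z = (1/R) *\<^sub>R (z - p)"
        by (simp add: algebra_simps)
      ultimately show ?thesis using R by (simp del: id_apply)
    qed
  qed (use assms R in auto)
  then show ?thesis by (rule that) simp
qed

section \<open>Handling the two suprema\<close>

lemma squeezing_radius_le_1:
  fixes f :: "complex ^ 'n \<Rightarrow> complex ^ 'n"
  assumes "holomorphic_embedding D f" and "0 < r" and "ball 0 r \<subseteq> f ` D"
  shows "r \<le> 1"
proof -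
  have "ball (0 :: complex ^ 'n) r \<subseteq> ball 0 1"
    using assms unfolding holomorphic_embedding_def by blast
  then show ?thesis using \<open>0 < r\<close> by (simp add: ball_subset_ball_iff)
qed

lemma squeezing_at_upper:
  assumes "holomorphic_embedding D f" and "0 < r" and "ball 0 r \<subseteq> f ` D"
  shows "r \<le> squeezing_at D f"
  unfolding squeezing_at_def
  using assms squeezing_radius_le_1 by (intro cSup_upper bdd_aboveI[where M = 1]) blast+

text \<open>The image of \<open>D\<close> is open and contains \<open>f p = 0\<close>. This makes
  the set of radii in \<open>squeezing_at\<close> nonempty, as \<open>cSup_least\<close>
  demands.\<close>

lemma squeezing_radius_exists:
  assumes "holomorphic_embedding D f" and "open D" and "p \<in> D" and "f p = 0"
  obtains r where "0 < r" and "ball 0 r \<subseteq> f ` D"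
  using holomorphic_embedding_open_image[OF assms(1,2,2) subset_refl] assms(3,4)
  by (metis image_eqI openE)

lemma squeezing_at_least:
  assumes "holomorphic_embedding D f" and "open D" and "p \<in> D" and "f p = 0"
    and "\<And>r. 0 < r \<Longrightarrow> ball 0 r \<subseteq> f ` D \<Longrightarrow> r \<le> s"
  shows "squeezing_at D f \<le> s"
  unfolding squeezing_at_def
proof (rule cSup_least)
  obtain r where "0 < r" "ball 0 r \<subseteq> f ` D"
    using squeezing_radius_exists[OF assms(1-4)] .
  then show "{r. 0 < r \<and> ball 0 r \<subseteq> f ` D} \<noteq> {}" by blast
qed (use assms(5) in auto)

lemma squeezing_function_upper:
  assumes "holomorphic_embedding D f" and "open D" and "p \<in> D" and "f p = 0"
  shows "squeezing_at D f \<le> squeezing_function D p"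
  unfolding squeezing_function_def
proof (rule cSUP_upper)
  \<comment> \<open>Every admissible radius is at most 1, hence so is each inner supremum.\<close>
  show "bdd_above (squeezing_at D ` {f. holomorphic_embedding D f \<and> f p = 0})"
  proof (rule bdd_aboveI2[where M = 1])
    fix g assume "g \<in> {f. holomorphic_embedding D f \<and> f p = 0}"
    then have g: "holomorphic_embedding D g" "g p = 0" by auto
    show "squeezing_at D g \<le> 1"
      by (rule squeezing_at_least[OF g(1) assms(2,3) g(2)]) (rule squeezing_radius_le_1[OF g(1)])
  qed
qed (use assms in simp)

text \<open>This removes both suprema at once: an upper bound has to be checked only for a single
  embedding and a single radius. Boundedness of \<open>D\<close> guarantees that the family of
  embeddings is nonempty.\<close>

lemma squeezing_function_least:
  fixes D :: "(complex ^ 'n) set"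
  assumes "open D" and "bounded D" and "p \<in> D"
    and "\<And>f r. holomorphic_embedding D f \<Longrightarrow> f p = 0 \<Longrightarrow> 0 < r \<Longrightarrow> ball 0 r \<subseteq> f ` D \<Longrightarrow> r \<le> s"
  shows "squeezing_function D p \<le> s"
  unfolding squeezing_function_def
proof (rule cSUP_least)
  show "{f. holomorphic_embedding D f \<and> f p = 0} \<noteq> {}"
    by (rule holomorphic_embedding_exists[OF assms(1,2), of p]) auto
next
  fix f assume "f \<in> {f. holomorphic_embedding D f \<and> f p = 0}"
  then show "squeezing_at D f \<le> s"
    using assms(4) by (intro squeezing_at_least[OF _ assms(1,3)]) auto
qed

lemma squeezing_function_bounds:
  fixes D :: "(complex ^ 'n) set"
  assumes "open D" and "bounded D" and "p \<in> D"
  shows "0 < squeezing_function D p" and "squeezing_function D p \<le> 1"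
proof -
  obtain f where f: "holomorphic_embedding D f" "f p = 0"
    using holomorphic_embedding_exists[OF assms(1,2)] .
  obtain r where "0 < r" "ball 0 r \<subseteq> f ` D"
    using squeezing_radius_exists[OF f(1) assms(1,3) f(2)] .
  then show "0 < squeezing_function D p"
    using squeezing_at_upper[OF f(1)] squeezing_function_upper[OF f(1) assms(1,3) f(2)]
    by fastforce
  show "squeezing_function D p \<le> 1"
    using assms squeezing_radius_le_1 by (intro squeezing_function_least) auto
qed

section \<open>Moving the base point and the Lipschitz estimate\<close>

lemma recentred_embedding:
  fixes f :: "complex ^ 'n \<Rightarrow> complex ^ 'n"
  assumes f: "holomorphic_embedding D f" and "open D" and "q \<in> D"
  defines "a \<equiv> f q"
  assumes r: "norm a < r" "ball 0 r \<subseteq> f ` D"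
  obtains g where "holomorphic_embedding D g" and "g q = 0"
    and "ball 0 ((r - norm a) / (1 + norm a)) \<subseteq> g ` D"
proof
  \<comment> \<open>Since \<open>f\<close> takes values in the unit ball, \<open>f z - a\<close> has
    norm below \<open>1 + norm a\<close>; the factor \<open>c\<close> brings it back into the unit
    ball.\<close>
  define c where "c = 1 / (1 + norm a)"
  define g where "g = (\<lambda>z. - c *\<^sub>R a + c *\<^sub>R f z)"
  have pos: "0 < 1 + norm a" using norm_ge_zero[of a] by linarith
  have g: "g z = c *\<^sub>R (f z - a)" for z by (simp add: g_def algebra_simps)
  show "holomorphic_embedding D g"
    unfolding g_def
  proof (rule holomorphic_embedding_affine)
    fix z assume "z \<in> D"
    then have "norm (f z) < 1" using f unfolding holomorphic_embedding_def by auto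
    then have "norm (f z - a) < 1 + norm a" using norm_triangle_ineq4[of "f z" a] by linarith
    then have "norm (g z) < 1" using pos by (simp add: g c_def)
    then show "norm (- c *\<^sub>R a + c *\<^sub>R f z) < 1" by (simp add: g_def)
  qed (use f holomorphic_embedding_open_image[OF f \<open>open D\<close>] \<open>open D\<close> pos in
      \<open>auto simp: holomorphic_embedding_def c_def\<close>)
  show "g q = 0" by (simp add: g a_def)
  show "ball 0 ((r - norm a) / (1 + norm a)) \<subseteq> g ` D"
  proof
    fix y :: "complex ^ 'n" assume "y \<in> ball 0 ((r - norm a) / (1 + norm a))"
    then have "norm y * (1 + norm a) < r - norm a" using pos by (simp add: pos_less_divide_eq)
    moreover have "norm (a + (1 + norm a) *\<^sub>R y) \<le> norm a + norm y * (1 + norm a)"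
      using norm_triangle_ineq[of a "(1 + norm a) *\<^sub>R y"] pos by (simp add: mult.commute)
    \<comment> \<open>The point is the preimage of \<open>y\<close> under the affine map sending
      \<open>x\<close> to \<open>c *\<^sub>R (x - a)\<close>; its norm is less than
      \<open>r\<close>.\<close>
    ultimately have "a + (1 + norm a) *\<^sub>R y \<in> f ` D" using r(2) by auto
    then obtain z where "z \<in> D" "f z = a + (1 + norm a) *\<^sub>R y" by (metis imageE)
    moreover from this have "g z = y" using pos by (simp add: g c_def)
    ultimately show "y \<in> g ` D" by blast
  qed
qed

text \<open>Any embedding centred at \<open>p\<close> competes at \<open>q\<close> after recentring,
  at a loss of at most \<open>2 * a\<close> in the radius, where \<open>a = norm (f q)\<close>. The
  estimate is one-sided; exchanging \<open>p\<close> and \<open>q\<close> gives the other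
  side.\<close>

lemma squeezing_function_diff_le:
  fixes D :: "(complex ^ 'n) set"
  assumes D: "open D" "bounded D" and "0 < d" and ball: "ball p d \<subseteq> D" and q: "dist p q < d"
  shows "squeezing_function D p - squeezing_function D q \<le> 2 * CARD('n) * dist p q / d"
proof -
  have pq: "p \<in> D" "q \<in> D" using ball q \<open>0 < d\<close> by auto
  let ?s = "squeezing_function D q"
  let ?e = "CARD('n) * dist p q / d"
  note s = squeezing_function_bounds[OF D pq(2)]
  have "squeezing_function D p \<le> ?s + 2 * ?e"
  proof (rule squeezing_function_least[OF D pq(1)])
    fix f :: "complex ^ 'n \<Rightarrow> complex ^ 'n" and r
    assume f: "holomorphic_embedding D f" "f p = 0" and r: "0 < r" "ball 0 r \<subseteq> f ` D"
    define a where "a = norm (f q)"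
    \<comment> \<open>The factor \<open>CARD('n)\<close> arises here, from adding the Schwarz bounds
      of the components.\<close>
    have "a \<le> (\<Sum>i\<in>UNIV. norm (f q $ i))"
      unfolding a_def by (rule norm_vec_le_sum_components)
    also have "\<dots> \<le> (\<Sum>i\<in>(UNIV :: 'n set). dist p q / d)"
      using f \<open>0 < d\<close> ball q unfolding holomorphic_embedding_def
      by (intro sum_mono schwarz_component_bound) auto
    finally have a: "a \<le> ?e" by simp
    have "0 \<le> a" by (simp add: a_def)
    have "r \<le> ?s + 2 * a"
    proof (cases "a < r")
      case True
      obtain g where g: "holomorphic_embedding D g" "g q = 0"
        and sub: "ball 0 ((r - a) / (1 + a)) \<subseteq> g ` D"
        using recentred_embedding[OF f(1) D(1) pq(2) _ r(2)] True unfolding a_def by blast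
      have "(r - a) / (1 + a) \<le> ?s"
        using squeezing_at_upper[OF g(1) _ sub] squeezing_function_upper[OF g(1) D(1) pq(2) g(2)]
          True \<open>0 \<le> a\<close> by simp
      then have "r - a \<le> ?s * (1 + a)" using \<open>0 \<le> a\<close> by (simp add: pos_divide_le_eq)
      \<comment> \<open>One \<open>a\<close> comes from the shift and the other from the scaling,
        where \<open>?s \<le> 1\<close> gives \<open>?s * (1 + a) \<le> ?s + a\<close>.\<close>
      moreover have "?s * a \<le> 1 * a" using s(2) \<open>0 \<le> a\<close> by (rule mult_right_mono)
      ultimately show ?thesis by (simp add: algebra_simps)
    next
      case False
      \<comment> \<open>Here \<open>r \<le> a\<close>, so positivity of \<open>?s\<close>
        suffices.\<close>
      then show ?thesis using s(1) \<open>0 \<le> a\<close> by linarith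
    qed
    then show "r \<le> ?s + 2 * ?e" using a by linarith
  qed
  then show ?thesis by simp
qed

theorem theorem3p1:
  fixes D :: "(complex ^ 'n) set"
  assumes "open D" and "connected D" and "bounded D"
  shows "continuous_on D (squeezing_function D)"
proof (rule continuous_at_imp_continuous_on, rule ballI)
  fix p assume "p \<in> D"
  then obtain e where e: "0 < e" "ball p e \<subseteq> D" using \<open>open D\<close> openE by blast
  \<comment> \<open>Halving the radius leaves room for a ball of radius \<open>d\<close> in
    \<open>D\<close> around every \<open>q\<close> within \<open>d\<close> of \<open>p\<close>, so
    the one-sided estimate can be used from \<open>p\<close> and from \<open>q\<close> with the same
    constant.\<close>
  define d where "d = e / 2"
  have d: "0 < d" "ball p (2 * d) \<subseteq> D" using e by (auto simp: d_def)
  have bound: "dist (squeezing_function D q) (squeezing_function D p) \<le> 2 * CARD('n) * dist p q / d"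
    if q: "dist p q < d" for q
  proof -
    have "ball q d \<subseteq> ball p (2 * d)" "ball p d \<subseteq> ball p (2 * d)"
      using q d by (auto simp: ball_subset_ball_iff dist_commute)
    then have "ball q d \<subseteq> D" "ball p d \<subseteq> D" using d(2) by auto
    then show ?thesis
      using squeezing_function_diff_le[OF assms(1,3) d(1), of p q]
        squeezing_function_diff_le[OF assms(1,3) d(1), of q p] q
      by (auto simp: dist_real_def dist_commute)
  qed
  show "isCont (squeezing_function D) p"
    unfolding isCont_def
  proof (rule metric_tendsto_imp_tendsto)
    have "((\<lambda>q. 2 * CARD('n) * dist p q / d) \<longlongrightarrow> 2 * CARD('n) * dist p p / d) (at p)"
      using d by (intro tendsto_intros) auto
    then show "((\<lambda>q. 2 * CARD('n) * dist p q / d) \<longlongrightarrow> 0) (at p)" by simp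
    have "dist (squeezing_function D q) (squeezing_function D p)
        \<le> dist (2 * CARD('n) * dist p q / d) 0" if "dist q p < d" for q
      using bound[of q] that d(1) by (simp add: dist_commute)
    then show "\<forall>\<^sub>F q in at p. dist (squeezing_function D q) (squeezing_function D p)
        \<le> dist (2 * CARD('n) * dist p q / d) 0"
      unfolding eventually_at using d(1) by blast
  qed
qed

end
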